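(* Let $G$ be a planar $1$-flow network. Then the undirected square of $G$ is a weak bar $1$-visibility graph.
   Context: A digraph is upward planar if it admits a planar drawing in which every edge is drawn as a curve strictly monotonically increasing in the vertical direction (in particular it is acyclic). A planar $1$-flow network is a finite upward planar digraph in which every vertex $v$ satisfies $\min\{\mathrm{indeg}(v),\mathrm{outdeg}(v)\}\le 1$. The (undirected) square of a digraph $G=(V,E)$ is the undirected graph on $V$ having an edge $uv$ whenever $u\neq v$ and there is a directed path of length at most two from $u$ to $v$ or from $v$ to $u$ in $G$. A bar layout is a finite set of pairwise non-intersecting horizontal segments (bars); two bars are $1$-visible if there is an axis-aligned rectangle of non-zero width with bottom side on one bar and top side on the other intersecting at most one other bar. A graph is a weak bar $1$-visibility graph if it is isomorphic to a spanning subgraph of the graph whose vertices are the bars of some bar layout and whose edges are the $1$-visible pairs. *)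

theory Defs
  imports "HOL-Analysis.Analysis" "Graph_Theory.Graph_Theory"
begin

text \<open>Parallel arcs are allowed; they are separate arcs drawn as separate curves.\<close>

definition planar_drawing ::
  "('a, 'b) pre_digraph \<Rightarrow> ('a \<Rightarrow> real \<times> real) \<Rightarrow> ('b \<Rightarrow> real \<Rightarrow> real \<times> real) \<Rightarrow> bool" where
  "planar_drawing G pos curve \<longleftrightarrow>
     inj_on pos (verts G) \<and>
     (\<forall>e\<in>arcs G. simple_path (curve e) \<and>
        pathstart (curve e) = pos (tail G e) \<and> pathfinish (curve e) = pos (head G e) \<and>
        path_image (curve e) \<inter> pos ` verts G \<subseteq> {pos (tail G e), pos (head G e)}) \<and>
     (\<forall>e\<in>arcs G. \<forall>f\<in>arcs G. e \<noteq> f \<longrightarrow>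
        path_image (curve e) \<inter> path_image (curve f)
          \<subseteq> pos ` ({tail G e, head G e} \<inter> {tail G f, head G f}))"

definition upward_planar :: "('a, 'b) pre_digraph \<Rightarrow> bool" where
  "upward_planar G \<longleftrightarrow>
     (\<exists>pos curve. planar_drawing G pos curve \<and>
        (\<forall>e\<in>arcs G. strict_mono_on {0..1} (\<lambda>t. snd (curve e t))))"

definition planar_1_flow_network :: "('a, 'b) pre_digraph \<Rightarrow> bool" where
  "planar_1_flow_network G \<longleftrightarrow>
     fin_digraph G \<and> upward_planar G \<and>
     (\<forall>v\<in>verts G. min (in_degree G v) (out_degree G v) \<le> 1)"

text \<open>As in \<^theory>\<open>Graph_Theory.Digraph\<close>, undirected graphs are symmetric digraphs.\<close>

definition undirected_square :: "('a, 'b) pre_digraph \<Rightarrow> 'a pair_pre_digraph" where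
  "undirected_square G =
     \<lparr> pverts = verts G,
       parcs = {(u, v). u \<noteq> v \<and>
         (\<exists>p. length p \<le> 2 \<and> (pre_digraph.apath G u p v \<or> pre_digraph.apath G v p u))} \<rparr>"

definition bar :: "(real \<times> real) set \<Rightarrow> bool" where
  "bar b \<longleftrightarrow> (\<exists>l r y. l < r \<and> b = {l..r} \<times> {y})"

definition bar_layout :: "(real \<times> real) set set \<Rightarrow> bool" where
  "bar_layout B \<longleftrightarrow> finite B \<and> (\<forall>b\<in>B. bar b) \<and> pairwise disjnt B"

text \<open>The two bars containing the bottom and top side do not count as intersected bars.\<close>

definition one_visible ::
  "(real \<times> real) set set \<Rightarrow> (real \<times> real) set \<Rightarrow> (real \<times> real) set \<Rightarrow> bool" where
  "one_visible B b c \<longleftrightarrow>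
     (\<exists>x1 x2 y1 y2. x1 < x2 \<and> y1 < y2 \<and>
        ({x1..x2} \<times> {y1} \<subseteq> b \<and> {x1..x2} \<times> {y2} \<subseteq> c \<or>
         {x1..x2} \<times> {y1} \<subseteq> c \<and> {x1..x2} \<times> {y2} \<subseteq> b) \<and>
        card {d \<in> B - {b, c}. d \<inter> ({x1..x2} \<times> {y1..y2}) \<noteq> {}} \<le> 1)"

definition bar_1_visibility_graph ::
  "(real \<times> real) set set \<Rightarrow> (real \<times> real) set pair_pre_digraph" where
  "bar_1_visibility_graph B =
     \<lparr> pverts = B, parcs = {(b, c). b \<in> B \<and> c \<in> B \<and> b \<noteq> c \<and> one_visible B b c} \<rparr>"

text \<open>
  The spanning subgraph \<open>H\<close> is required to be a \<^const>\<open>graph\<close>, since a subgraph of a symmetric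
  digraph need not be symmetric.
\<close>

definition weak_bar_1_visibility_graph :: "('a, 'b) pre_digraph \<Rightarrow> bool" where
  "weak_bar_1_visibility_graph G \<longleftrightarrow>
     (\<exists>B H. bar_layout B \<and> graph H \<and> spanning H (with_proj (bar_1_visibility_graph B)) \<and>
        digraph_iso G H)"

end

theory Submission
  imports Defs
begin

text \<open>
  Every bar is placed at the height of its vertex in the drawing. Call an arc into a vertex \<open>w\<close>
  followed by an arc out of \<open>w\<close> (either of them possibly missing) a thread. Since \<open>w\<close> has at most
  one arc on one of its sides, two threads never cross: at all common heights they compare in the
  same direction. Being to the left of is then acyclic on threads: of three consecutive threads,
  the one in the middle can be dropped if its upper end is lowest, because both neighbours reach
  that height and are compared directly with each other. Number the threads compatibly and
  give each number a column of the plane; the bar of a vertex extends from the first to the last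
  column of the threads through it. Between its two ends, the column of a thread meets exactly the
  bars of the vertices on the thread, since any other bar it met would have one of its threads on the
  wrong side.
\<close>

section \<open>Horizontal comparison of upward curves\<close>

text \<open>Graph of a continuous function over a compact height interval, encoded as a point set so
  that parametrisations disappear. A single point is allowed, since a vertex alone must
  count.\<close>

definition strand :: "(real \<times> real) set \<Rightarrow> bool" where
  "strand S \<longleftrightarrow> compact S \<and> topological_space_class.connected S \<and> S \<noteq> {} \<and> inj_on snd S"

text \<open>One common height serves as witness; that all common heights agree is a separate
  property, which holds for threads.\<close>

definition left_of :: "(real \<times> real) set \<Rightarrow> (real \<times> real) set \<Rightarrow> bool" where
  "left_of S T \<longleftrightarrow> (\<exists>a b y. (a, y) \<in> S \<and> (b, y) \<in> T \<and> a < b)"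

section \<open>Strands as graphs over a height interval\<close>

lemma strand_unique: "strand S \<Longrightarrow> p \<in> S \<Longrightarrow> q \<in> S \<Longrightarrow> snd p = snd q \<Longrightarrow> p = q"
  by (auto simp: strand_def dest: inj_onD)

lemma strand_between:
  assumes "strand S" "p \<in> S" "q \<in> S" "snd p \<le> y" "y \<le> snd q"
  obtains x where "(x, y) \<in> S"
proof -
  have "topological_space_class.connected (snd ` S)"
    using assms(1) unfolding strand_def by (intro connected_continuous_image continuous_intros) auto
  then have "y \<in> snd ` S"
    using assms connectedD_interval[of "snd ` S" "snd p" "snd q" y] by auto
  then show ?thesis
    using that by auto
qed

text \<open>On a compact set the continuous injection \<open>snd\<close> has a continuous inverse;
  its first coordinate is the required function.\<close>

lemma strand_graph:
  assumes "strand S"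
  shows "\<exists>X. continuous_on (snd ` S) X \<and> (\<forall>y\<in>snd ` S. (X y, y) \<in> S) \<and>
    (\<forall>x y. (x, y) \<in> S \<longrightarrow> x = X y)"
proof -
  let ?g = "the_inv_into S snd"
  have inj: "inj_on snd S" and "compact S"
    using assms by (auto simp: strand_def)
  have "continuous_on (snd ` S) ?g"
    using \<open>compact S\<close> inj
    by (intro continuous_on_inv) (auto intro!: continuous_intros simp: the_inv_into_f_f)
  then have "continuous_on (snd ` S) (\<lambda>y. fst (?g y))"
    by (intro continuous_intros)
  moreover have "(fst (?g y), y) \<in> S" if "y \<in> snd ` S" for y
    using that the_inv_into_f_f[OF inj] by auto
  moreover have "x = fst (?g y)" if "(x, y) \<in> S" for x y
    using the_inv_into_f_f[OF inj that] by simp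
  ultimately show ?thesis
    by (intro exI[of _ "\<lambda>y. fst (?g y)"]) simp
qed

text \<open>Intermediate value theorem for the difference of the two horizontal coordinates, which
  changes sign between the witnesses of the two comparisons.\<close>

lemma strand_crossing:
  assumes S: "strand S" and T: "strand T"
    and "left_of S T" "left_of T S"
  obtains p s t s' t' where "p \<in> S" "p \<in> T" "s \<in> S" "s' \<in> S" "t \<in> T" "t' \<in> T"
    "snd s = snd t" "snd s' = snd t'" "snd s < snd p" "snd p < snd s'" "s \<noteq> t" "s' \<noteq> t'"
proof -
  obtain a b y1 where 1: "(a, y1) \<in> S" "(b, y1) \<in> T" "a < b"
    using assms(3) by (auto simp: left_of_def)
  obtain a' b' y2 where 2: "(a', y2) \<in> S" "(b', y2) \<in> T" "b' < a'"
    using assms(4) by (auto simp: left_of_def)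
  obtain X where X: "continuous_on (snd ` S) X" "\<And>y. y \<in> snd ` S \<Longrightarrow> (X y, y) \<in> S"
      "\<And>x y. (x, y) \<in> S \<Longrightarrow> x = X y"
    using strand_graph[OF S] by metis
  obtain Z where Z: "continuous_on (snd ` T) Z" "\<And>y. y \<in> snd ` T \<Longrightarrow> (Z y, y) \<in> T"
      "\<And>x y. (x, y) \<in> T \<Longrightarrow> x = Z y"
    using strand_graph[OF T] by metis
  let ?J = "{min y1 y2..max y1 y2}"
  have common: "y \<in> snd ` S" "y \<in> snd ` T" if "y \<in> ?J" for y
  proof -
    have "\<exists>x. (x, y) \<in> R" if "strand R" "(c, y1) \<in> R" "(d, y2) \<in> R" for R c d
    proof (cases "y1 \<le> y2")
      case True
      then show ?thesis
        using strand_between[OF that(1-3), of y] \<open>y \<in> ?J\<close> by auto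
    next
      case False
      then show ?thesis
        using strand_between[OF that(1,3,2), of y] \<open>y \<in> ?J\<close> by auto
    qed
    then show "y \<in> snd ` S" "y \<in> snd ` T"
      using 1 2 S T by force+
  qed
  let ?d = "\<lambda>y. Z y - X y"
  have "continuous_on ?J ?d"
    using common by (intro continuous_intros continuous_on_subset[OF X(1)]
        continuous_on_subset[OF Z(1)]) auto
  then have "topological_space_class.connected (?d ` ?J)"
    by (intro connected_continuous_image) auto
  moreover have "?d y1 > 0" "?d y2 < 0"
    using 1 2 X(3) Z(3) by force+
  moreover have "?d y1 \<in> ?d ` ?J" "?d y2 \<in> ?d ` ?J"
    by (auto intro!: imageI)
  ultimately have "0 \<in> ?d ` ?J"
    using connectedD_interval[of "?d ` ?J" "?d y2" "?d y1" 0] by linarith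
  then obtain y where y: "y \<in> ?J" "X y = Z y"
    by auto
  have "y \<noteq> y1" "y \<noteq> y2"
    using y \<open>?d y1 > 0\<close> \<open>?d y2 < 0\<close> by auto
  have "(X y, y) \<in> S" "(X y, y) \<in> T"
    using X(2) Z(2) common[OF y(1)] y(2) by (blast, metis)
  note both = this
  consider "y1 < y" "y < y2" | "y2 < y" "y < y1"
    using y(1) \<open>y \<noteq> y1\<close> \<open>y \<noteq> y2\<close> by force
  \<comment> \<open>Either witness may be the lower one. The conclusion records only that the points
    differ, not their order, so exchanging the witnesses settles the second case.\<close>
  then show ?thesis
  proof cases
    case A: 1
    show ?thesis
      by (rule that[OF both 1(1) 2(1) 1(2) 2(2)]) (use A 1(3) 2(3) in simp_all)
  next
    case A: 2
    show ?thesis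
      by (rule that[OF both 2(1) 1(1) 2(2) 1(2)]) (use A 1(3) 2(3) in simp_all)
  qed
qed

text \<open>Both comparisons with \<open>P\<close> happen no higher than its upper end, and
  \<open>Q\<close> and \<open>R\<close> reach that height. So the strand compared at the lower
  height can be followed up to the higher one, where asymmetry keeps it weakly on its side of
  \<open>P\<close>.\<close>

lemma left_of_trans_lowest:
  assumes str: "strand Q" "strand P" "strand R"
    and QP: "left_of Q P" "\<not> left_of P Q" and PR: "left_of P R" "\<not> left_of R P"
    and top: "p \<in> P" "\<And>s. s \<in> P \<Longrightarrow> snd s \<le> snd p"
    and reach: "q \<in> Q" "snd p \<le> snd q" "r \<in> R" "snd p \<le> snd r"
  shows "left_of Q R"
proof -
  obtain a b y where 1: "(a, y) \<in> Q" "(b, y) \<in> P" "a < b"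
    using QP by (auto simp: left_of_def)
  obtain c d z where 2: "(c, z) \<in> P" "(d, z) \<in> R" "c < d"
    using PR by (auto simp: left_of_def)
  have "y \<le> snd p" "z \<le> snd p"
    using top 1 2 by force+
  show ?thesis
  proof (cases "y \<le> z")
    case True
    obtain x where "(x, z) \<in> Q"
      using strand_between[OF str(1), of "(a, y)" q z] 1 reach True \<open>z \<le> snd p\<close> by auto
    moreover have "x \<le> c"
      using \<open>(x, z) \<in> Q\<close> 2 QP(2) by (force simp: left_of_def)
    ultimately show ?thesis
      using 2 by (force simp: left_of_def)
  next
    case False
    obtain x where "(x, y) \<in> R"
      using strand_between[OF str(3), of "(d, z)" r y] 2 reach False \<open>y \<le> snd p\<close> by auto
    moreover have "b \<le> x"
      using \<open>(x, y) \<in> R\<close> 1 PR(2) by (force simp: left_of_def)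
    ultimately show ?thesis
      using 1 by (force simp: left_of_def)
  qed
qed

text \<open>Strands are inserted by decreasing upper end. The new one is then lowest, so everything
  on its left is already to the left of everything on its right, and a number between the two groups
  exists.\<close>

lemma strand_numbering:
  assumes "finite F" "\<And>S. S \<in> F \<Longrightarrow> strand S"
    and "\<And>S T. S \<in> F \<Longrightarrow> T \<in> F \<Longrightarrow> left_of S T \<Longrightarrow> \<not> left_of T S"
  shows "\<exists>r :: (real \<times> real) set \<Rightarrow> nat. \<forall>S\<in>F. \<forall>T\<in>F. left_of S T \<longrightarrow> r S < r T"
proof -
  define top where "top S = Sup (snd ` S)" for S :: "(real \<times> real) set"
  have top: "\<exists>p\<in>S. snd p = top S" "\<And>s. s \<in> S \<Longrightarrow> snd s \<le> top S" if "strand S" for S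
  proof -
    have "compact (snd ` S)" "snd ` S \<noteq> {}"
      using that by (auto simp: strand_def intro!: compact_continuous_image continuous_intros)
    then have "top S \<in> snd ` S" "bdd_above (snd ` S)"
      unfolding top_def
      by (auto intro!: closed_contains_Sup compact_imp_closed bounded_imp_bdd_above compact_imp_bounded)
    then show "\<exists>p\<in>S. snd p = top S" "\<And>s. s \<in> S \<Longrightarrow> snd s \<le> top S"
      by (force, auto simp: top_def intro: cSup_upper)
  qed
  show ?thesis
    using assms
  proof (induction F rule: finite_ranking_induct[where f = "\<lambda>S. - top S"])
    case empty
    then show ?case by simp
  next
    case (insert P F)
    have "\<exists>r :: _ \<Rightarrow> nat. \<forall>S\<in>F. \<forall>T\<in>F. left_of S T \<longrightarrow> r S < r T"
      using insert.prems by (intro insert.IH) auto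
    then obtain r :: "_ \<Rightarrow> nat"
      where r: "\<And>S T. S \<in> F \<Longrightarrow> T \<in> F \<Longrightarrow> left_of S T \<Longrightarrow> r S < r T"
      by blast
    define L where "L = {S \<in> F. left_of S P}"
    \<comment> \<open>Old strands move to odd numbers, which frees an even one for \<open>P\<close>
      just above the last strand on its left; 0 is used if there is none.\<close>
    define m where "m = Max (insert 0 ((\<lambda>S. 2 * r S + 2) ` L))"
    define r' where "r' S = (if S = P then m else 2 * r S + 1)" for S
    have "finite L"
      using insert.hyps(1) by (simp add: L_def)
    have trans: "left_of Q R" if "Q \<in> F" "R \<in> F" "left_of Q P" "left_of P R" for Q R
    proof -
      have str: "strand Q" "strand P" "strand R"
        using insert.prems(1) that(1,2) by blast+
      have asym: "\<not> left_of P Q" "\<not> left_of R P"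
        using insert.prems(2) that by blast+
      obtain p q s where "p \<in> P" "snd p = top P" "q \<in> Q" "snd q = top Q" "s \<in> R" "snd s = top R"
        using top(1)[OF str(1)] top(1)[OF str(2)] top(1)[OF str(3)] by blast
      moreover have "top P \<le> top Q" "top P \<le> top R"
        using insert.hyps(2) that(1,2) by force+
      ultimately show ?thesis
        using left_of_trans_lowest[OF str that(3) asym(1) that(4) asym(2), of p q s]
          top(2)[OF str(2)] by auto
    qed
    have "r' S < r' T" if "S \<in> insert P F" "T \<in> insert P F" "left_of S T" for S T
    proof -
      have "S \<noteq> T"
        using insert.prems(2) that by blast
      consider "S \<noteq> P" "T \<noteq> P" | "T = P" "S \<noteq> P" | "S = P" "T \<noteq> P"
        using \<open>S \<noteq> T\<close> by auto
      then show ?thesis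
      proof cases
        case 1
        then show ?thesis
          using r that by (auto simp: r'_def)
      next
        case 2
        then have "2 * r S + 2 \<le> m"
          using \<open>finite L\<close> that by (auto simp: m_def L_def intro!: Max_ge)
        then show ?thesis
          using 2 by (auto simp: r'_def)
      next
        case 3
        \<comment> \<open>Either \<open>m\<close> is 0 or it comes from some \<open>Q\<close> left
          of \<open>P\<close>; then \<open>r Q < r T\<close> by \<open>trans\<close>, and
          \<open>2 * r Q + 2\<close> is still below \<open>2 * r T + 1\<close>.\<close>
        have "m \<in> insert 0 ((\<lambda>S. 2 * r S + 2) ` L)"
          unfolding m_def using \<open>finite L\<close> by (intro Max_in) auto
        moreover have "r Q < r T" if "Q \<in> L" for Q
          using r[OF _ _ trans] 3 \<open>T \<in> insert P F\<close> \<open>left_of S T\<close> that by (simp add: L_def)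
        ultimately have "m < 2 * r T + 1"
          by fastforce
        then show ?thesis
          using 3 by (auto simp: r'_def)
      qed
    qed
    then show ?case by blast
  qed
qed

section \<open>Threads of a drawing\<close>

locale upward_1_flow_drawing = fin_digraph G for G :: "('a, 'b) pre_digraph" (structure) +
  fixes pos :: "'a \<Rightarrow> real \<times> real" and curve :: "'b \<Rightarrow> real \<Rightarrow> real \<times> real"
  assumes drawing: "planar_drawing G pos curve"
    and upward: "\<And>e. e \<in> arcs G \<Longrightarrow> strict_mono_on {0..1} (\<lambda>t. snd (curve e t))"
    and flow: "\<And>v. v \<in> verts G \<Longrightarrow> min (in_degree G v) (out_degree G v) \<le> 1"
begin

section \<open>Arcs and vertices in an upward planar drawing\<close>

abbreviation im :: "'b \<Rightarrow> (real \<times> real) set" where "im e \<equiv> path_image (curve e)"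
abbreviation height :: "'a \<Rightarrow> real" where "height v \<equiv> snd (pos v)"

lemma pos_inj: "v \<in> verts G \<Longrightarrow> w \<in> verts G \<Longrightarrow> pos v = pos w \<Longrightarrow> v = w"
  using drawing by (auto simp: planar_drawing_def dest: inj_onD)

lemma arc_ends:
  assumes "e \<in> arcs G"
  shows "pos (tail G e) \<in> im e" "pos (head G e) \<in> im e"
    "curve e 0 = pos (tail G e)" "curve e 1 = pos (head G e)"
proof -
  have "pathstart (curve e) = pos (tail G e)" "pathfinish (curve e) = pos (head G e)"
    using drawing assms by (auto simp: planar_drawing_def)
  then show "pos (tail G e) \<in> im e" "pos (head G e) \<in> im e"
      "curve e 0 = pos (tail G e)" "curve e 1 = pos (head G e)"
    using pathstart_in_path_image[of "curve e"] pathfinish_in_path_image[of "curve e"]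
    by (auto simp: pathstart_def pathfinish_def)
qed

lemma strand_arc:
  assumes "e \<in> arcs G"
  shows "strand (im e)"
proof -
  have "path (curve e)"
    using drawing assms by (auto simp: planar_drawing_def simple_path_imp_path)
  moreover have "inj_on snd (im e)"
    using strict_mono_on_imp_inj_on[OF upward[OF assms]]
    by (auto simp: path_image_def inj_on_def)
  ultimately show ?thesis
    by (auto simp: strand_def compact_path_image connected_path_image)
qed

lemma arc_height:
  assumes "e \<in> arcs G" "p \<in> im e"
  shows "height (tail G e) \<le> snd p" "snd p \<le> height (head G e)"
proof -
  obtain t where t: "0 \<le> t" "t \<le> 1" "p = curve e t"
    using assms(2) by (auto simp: path_image_def)
  have "mono_on {0..1} (\<lambda>t. snd (curve e t))"
    using upward[OF assms(1)] by (rule strict_mono_on_imp_mono_on)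
  then show "height (tail G e) \<le> snd p" "snd p \<le> height (head G e)"
    using mono_onD[of "{0..1}" "\<lambda>t. snd (curve e t)" 0 t]
      mono_onD[of "{0..1}" "\<lambda>t. snd (curve e t)" t 1] t arc_ends[OF assms(1)] by auto
qed

lemma arc_rises:
  assumes "e \<in> arcs G"
  shows "height (tail G e) < height (head G e)"
  using strict_mono_onD[OF upward[OF assms], of 0 1] arc_ends[OF assms] by simp

lemma vertex_on_arc:
  assumes "e \<in> arcs G" "v \<in> verts G" "pos v \<in> im e"
  shows "v = tail G e \<or> v = head G e"
proof -
  have "im e \<inter> pos ` verts G \<subseteq> {pos (tail G e), pos (head G e)}"
    using drawing assms by (auto simp: planar_drawing_def)
  then have "pos v = pos (tail G e) \<or> pos v = pos (head G e)"
    using assms(2,3) by blast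
  then show ?thesis
    using pos_inj[OF assms(2)] assms(1) by auto
qed

lemma arcs_meet:
  assumes "e \<in> arcs G" "f \<in> arcs G" "e \<noteq> f" "p \<in> im e" "p \<in> im f"
  obtains v where "v \<in> verts G" "p = pos v"
proof -
  have "im e \<inter> im f \<subseteq> pos ` ({tail G e, head G e} \<inter> {tail G f, head G f})"
    using drawing assms by (auto simp: planar_drawing_def)
  then have "p \<in> pos ` ({tail G e, head G e} \<inter> {tail G f, head G f})"
    using assms by blast
  then show ?thesis
    using that assms(1) tail_in_verts head_in_verts by blast
qed

text \<open>The sets \<open>A\<close> and \<open>B\<close> act as optional arcs:
  \<open>at_most_one_each\<close> makes each of them empty or a singleton. Inserting
  \<open>pos w\<close> keeps the thread nonempty when both are empty.\<close>

definition thread :: "'b set \<Rightarrow> 'a \<Rightarrow> 'b set \<Rightarrow> (real \<times> real) set" where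
  "thread A w B = insert (pos w) (\<Union>(im ` (A \<union> B)))"

definition at_most_one_each :: "'b set \<Rightarrow> 'a \<Rightarrow> 'b set \<Rightarrow> bool" where
  "at_most_one_each A w B \<longleftrightarrow> w \<in> verts G \<and> A \<subseteq> in_arcs G w \<and> B \<subseteq> out_arcs G w \<and>
     (\<forall>e\<in>A. \<forall>f\<in>A. e = f) \<and> (\<forall>e\<in>B. \<forall>f\<in>B. e = f)"

definition threads :: "(real \<times> real) set set" where
  "threads = {thread A w B |A w B. at_most_one_each A w B}"

section \<open>Geometry of a single thread\<close>

lemma at_most_one_eachD:
  assumes "at_most_one_each A w B"
  shows "w \<in> verts G" "e \<in> A \<Longrightarrow> e \<in> arcs G" "e \<in> B \<Longrightarrow> e \<in> arcs G"
    "e \<in> A \<Longrightarrow> head G e = w" "e \<in> B \<Longrightarrow> tail G e = w"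
    "e \<in> A \<Longrightarrow> f \<in> A \<Longrightarrow> e = f" "e \<in> B \<Longrightarrow> f \<in> B \<Longrightarrow> e = f"
  using assms by (auto simp: at_most_one_each_def in_arcs_def out_arcs_def)

lemma finite_threads: "finite threads"
proof -
  have "threads \<subseteq> (\<lambda>(A, w, B). thread A w B) ` (Pow (arcs G) \<times> verts G \<times> Pow (arcs G))"
    by (fastforce simp: threads_def at_most_one_each_def in_arcs_def out_arcs_def)
  then show ?thesis
    by (rule finite_subset) auto
qed

text \<open>Arcs in \<open>B\<close> start at \<open>w\<close> and rise, so they contribute nothing
  below it.\<close>

lemma thread_low:
  assumes "at_most_one_each A w B" "s \<in> thread A w B" "snd s < height w"
  obtains e where "e \<in> A" "s \<in> im e"
  using assms arc_height(1)[of _ s] at_most_one_eachD[OF assms(1)]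
  by (fastforce simp: thread_def)

lemma thread_high:
  assumes "at_most_one_each A w B" "s \<in> thread A w B" "height w < snd s"
  obtains e where "e \<in> B" "s \<in> im e"
  using assms arc_height(2)[of _ s] at_most_one_eachD[OF assms(1)]
  by (fastforce simp: thread_def)

lemma thread_at:
  assumes "at_most_one_each A w B" "s \<in> thread A w B" "snd s = height w"
  shows "s = pos w"
proof -
  have "s = pos w" if "s \<in> im e" "e \<in> A \<union> B" for e
    using strand_unique[OF strand_arc] arc_ends that assms(3) at_most_one_eachD[OF assms(1)]
    by (metis UnE)
  then show ?thesis
    using assms(2) by (auto simp: thread_def)
qed

lemma thread_low_in:
  assumes "at_most_one_each A w B" "e \<in> A" "s \<in> thread A w B" "snd s \<le> height w"
  shows "s \<in> im e"
proof (cases "snd s = height w")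
  case True
  then show ?thesis
    using thread_at[OF assms(1,3)] arc_ends(2)[of e] at_most_one_eachD[OF assms(1)] assms(2) by auto
next
  case False
  then obtain f where "f \<in> A" "s \<in> im f"
    using thread_low[OF assms(1,3)] assms(4) by auto
  then show ?thesis
    using at_most_one_eachD(6)[OF assms(1,2)] by blast
qed

lemma thread_high_in:
  assumes "at_most_one_each A w B" "e \<in> B" "s \<in> thread A w B" "height w \<le> snd s"
  shows "s \<in> im e"
proof (cases "snd s = height w")
  case True
  then show ?thesis
    using thread_at[OF assms(1,3)] arc_ends(1)[of e] at_most_one_eachD[OF assms(1)] assms(2) by auto
next
  case False
  then obtain f where "f \<in> B" "s \<in> im f"
    using thread_high[OF assms(1,3)] assms(4) by auto
  then show ?thesis
    using at_most_one_eachD(7)[OF assms(1,2)] by blast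
qed

text \<open>All pieces share \<open>pos w\<close>, which gives connectedness; the incoming and the
  outgoing piece overlap in height only at \<open>w\<close>, which gives injectivity of
  \<open>snd\<close>.\<close>

lemma strand_thread:
  assumes "at_most_one_each A w B"
  shows "strand (thread A w B)"
proof -
  note D = at_most_one_eachD[OF assms]
  have eq: "thread A w B = \<Union>(insert {pos w} (im ` (A \<union> B)))"
    by (auto simp: thread_def)
  have fin: "finite (A \<union> B)"
    by (rule finite_subset[of _ "arcs G"]) (auto dest: D(2,3))
  have "compact (thread A w B)"
    unfolding eq using fin strand_arc D by (intro compact_Union) (auto simp: strand_def)
  moreover have "topological_space_class.connected (thread A w B)"
  proof -
    have "pos w \<in> \<Inter>(insert {pos w} (im ` (A \<union> B)))"
      using arc_ends D by fastforce
    moreover have "topological_space_class.connected S" if "S \<in> insert {pos w} (im ` (A \<union> B))" for S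
      using that strand_arc D by (auto simp: strand_def)
    ultimately show ?thesis
      unfolding eq by (intro connected_Union) auto
  qed
  moreover have "inj_on snd (thread A w B)"
  proof (rule inj_onI)
    fix s t assume st: "s \<in> thread A w B" "t \<in> thread A w B" "snd s = snd t"
    consider "snd s = height w" | "snd s < height w" | "height w < snd s"
      by linarith
    then show "s = t"
    proof cases
      case 1
      then show ?thesis
        using thread_at[OF assms] st by metis
    next
      case 2
      then obtain e where "e \<in> A" "s \<in> im e"
        using thread_low[OF assms st(1)] by blast
      moreover from this have "t \<in> im e"
        using thread_low_in[OF assms] st 2 by simp
      ultimately show ?thesis
        using strand_unique[OF strand_arc] st(3) D by metis
    next
      case 3
      then obtain e where "e \<in> B" "s \<in> im e"
        using thread_high[OF assms st(1)] by blast
      moreover from this have "t \<in> im e"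
        using thread_high_in[OF assms] st 3 by simp
      ultimately show ?thesis
        using strand_unique[OF strand_arc] st(3) D by metis
    qed
  qed
  moreover have "thread A w B \<noteq> {}"
    by (simp add: thread_def)
  ultimately show ?thesis
    by (simp add: strand_def)
qed

lemma strand_if_thread: "T \<in> threads \<Longrightarrow> strand T"
  using strand_thread by (auto simp: threads_def)

text \<open>Apart from \<open>w\<close>, a thread meets only the tail of its incoming arc and the
  head of its outgoing arc. These are its lowest and highest points, which \<open>s\<close> and
  \<open>s'\<close> exclude.\<close>

lemma thread_inner_vertex:
  assumes "at_most_one_each A w B" "v \<in> verts G" "pos v \<in> thread A w B"
    and "s \<in> thread A w B" "s' \<in> thread A w B" "snd s < height v" "height v < snd s'"
  shows "v = w"
proof (rule ccontr)
  assume "v \<noteq> w"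
  note D = at_most_one_eachD[OF assms(1)]
  have "pos v \<noteq> pos w"
    using pos_inj[OF assms(2) D(1)] \<open>v \<noteq> w\<close> by blast
  then obtain e where e: "e \<in> A \<union> B" "pos v \<in> im e"
    using assms(3) by (auto simp: thread_def)
  show False
  proof (cases "e \<in> A")
    case True
    then have "v = tail G e"
      using vertex_on_arc[of e v] e assms(2) D \<open>v \<noteq> w\<close> by blast
    moreover have "snd s < height w"
      using True arc_height(2)[of e "pos v"] e assms D by force
    then have "s \<in> im e"
      using thread_low_in[OF assms(1) True assms(4)] by simp
    ultimately show False
      using arc_height(1)[of e s] True D assms(6) by force
  next
    case False
    then have "e \<in> B"
      using e by simp
    then have "v = head G e"
      using vertex_on_arc[of e v] e assms(2) D \<open>v \<noteq> w\<close> by blast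
    moreover have "height w < snd s'"
      using \<open>e \<in> B\<close> arc_height(1)[of e "pos v"] e assms D by force
    then have "s' \<in> im e"
      using thread_high_in[OF assms(1) \<open>e \<in> B\<close> assms(5)] by simp
    ultimately show False
      using arc_height(2)[of e s'] \<open>e \<in> B\<close> D assms(7) by force
  qed
qed

text \<open>Otherwise the threads meet at a point \<open>p\<close> and differ both below and above
  it. If \<open>p\<close> is a vertex, it is the middle of both threads and has two arcs in and two
  arcs out, against the flow condition. If not, planarity puts \<open>p\<close> on a common arc,
  which forces the threads to agree on one side of \<open>p\<close>.\<close>

lemma left_of_asym_threads:
  assumes "S \<in> threads" "T \<in> threads" "left_of S T"
  shows "\<not> left_of T S"
proof
  assume "left_of T S"
  obtain A w B where S: "S = thread A w B" and AB: "at_most_one_each A w B"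
    using assms by (auto simp: threads_def)
  obtain C z D where T: "T = thread C z D" and CD: "at_most_one_each C z D"
    using assms by (auto simp: threads_def)
  note DS = at_most_one_eachD[OF AB] and DT = at_most_one_eachD[OF CD]
  obtain p s t s' t' where
    pS: "p \<in> thread A w B" and pT: "p \<in> thread C z D"
    and s: "s \<in> thread A w B" "s' \<in> thread A w B" and t: "t \<in> thread C z D" "t' \<in> thread C z D"
    and lev: "snd s = snd t" "snd s' = snd t'" "snd s < snd p" "snd p < snd s'"
    and ne: "s \<noteq> t" "s' \<noteq> t'"
    using strand_crossing[OF strand_thread[OF AB] strand_thread[OF CD]] assms(3) \<open>left_of T S\<close> S T
    by metis
  have sep: "e \<noteq> f" if "e \<in> arcs G" "q \<in> im e" "q' \<in> im f" "q \<noteq> q'" "snd q = snd q'" for e f q q'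
    using strand_unique[OF strand_arc] that by metis
  have vertex: "v = w \<and> v = z" if "v \<in> verts G" "p = pos v" for v
    using thread_inner_vertex[OF AB, of v s s'] thread_inner_vertex[OF CD, of v t t']
      that pS pT s t lev by auto
  show False
  proof (cases "p = pos w")
    case True
    then have "w = z"
      using vertex DS(1) by blast
    obtain e where e: "e \<in> A" "s \<in> im e"
      using thread_low[OF AB s(1)] lev True by metis
    obtain f where f: "f \<in> C" "t \<in> im f"
      using thread_low[OF CD t(1)] lev True \<open>w = z\<close> by metis
    obtain e' where e': "e' \<in> B" "s' \<in> im e'"
      using thread_high[OF AB s(2)] lev True by metis
    obtain f' where f': "f' \<in> D" "t' \<in> im f'"
      using thread_high[OF CD t(2)] lev True \<open>w = z\<close> by metis
    \<comment> \<open>An arc has only one point at each height.\<close>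
    have "e \<noteq> f" "e' \<noteq> f'"
      using sep[of e s t f] sep[of e' s' t' f'] e f e' f' ne lev DS by auto
    moreover have "{e, f} \<subseteq> in_arcs G w" "{e', f'} \<subseteq> out_arcs G w"
      using e f e' f' DS DT \<open>w = z\<close> by (auto simp: in_arcs_def out_arcs_def)
    ultimately have "2 \<le> in_degree G w" "2 \<le> out_degree G w"
      using card_mono[OF finite_in_arcs[of w], of "{e, f}"]
        card_mono[OF finite_out_arcs[of w], of "{e', f'}"]
      by (simp_all add: in_degree_def out_degree_def)
    then show False
      using flow[OF DS(1)] by simp
  next
    case False
    then have nv: "p \<noteq> pos v" if "v \<in> verts G" for v
      using vertex that by blast
    obtain e where e: "e \<in> A \<union> B" "p \<in> im e"
      using pS False by (auto simp: thread_def)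
    obtain f where f: "f \<in> C \<union> D" "p \<in> im f"
      using pT nv[OF DT(1)] by (auto simp: thread_def)
    have "e \<in> arcs G" "f \<in> arcs G"
      using e(1) f(1) DS(2,3) DT(2,3) by auto
    then have ef: "f = e" "e \<in> arcs G"
      using arcs_meet[of e f p] nv e(2) f(2) by metis+
    have mid: "height (tail G e) \<le> snd p" "snd p \<le> height (head G e)"
      using arc_height[of e p] e ef by auto
    \<comment> \<open>The common arc may be incoming or outgoing in each thread. An arc outgoing in
      both carries \<open>s'\<close> and \<open>t'\<close>; in every other case it carries
      \<open>s\<close> and \<open>t\<close>.\<close>
    consider "e \<in> A" "e \<in> C" | "e \<in> B" "e \<in> D" | "e \<in> A" "e \<in> D" | "e \<in> B" "e \<in> C"
      using e f ef by auto
    then show False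
    proof cases
      case 1
      then have "s \<in> im e" "t \<in> im e"
        using thread_low_in[OF AB _ s(1)] thread_low_in[OF CD _ t(1)] mid lev DS DT by force+
      then show False
        using sep ne lev ef by blast
    next
      case 2
      then have "s' \<in> im e" "t' \<in> im e"
        using thread_high_in[OF AB _ s(2)] thread_high_in[OF CD _ t(2)] mid lev DS DT by force+
      then show False
        using sep ne lev ef by blast
    next
      case 3
      then have "s \<in> im e"
        using thread_low_in[OF AB _ s(1)] mid lev DS by force
      \<comment> \<open>Here the tail of \<open>e\<close> is \<open>z\<close>, so the level of
        \<open>s\<close> is not below \<open>z\<close>, and the point \<open>t\<close> at that level
        belongs to the outgoing arc of its thread.\<close>
      moreover from this have "t \<in> im e"
        using 3 thread_high_in[OF CD _ t(1)] arc_height(1)[of e s] ef lev DT by force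
      ultimately show False
        using sep ne lev ef by blast
    next
      case 4
      then have "t \<in> im e"
        using thread_low_in[OF CD _ t(1)] mid lev DT by force
      moreover from this have "s \<in> im e"
        using 4 thread_high_in[OF AB _ s(1)] arc_height(1)[of e t] ef lev DS by force
      ultimately show False
        using sep ne lev ef by blast
    qed
  qed
qed

section \<open>Threads for vertices and for short paths\<close>

lemma vertex_thread: "v \<in> verts G \<Longrightarrow> {pos v} \<in> threads"
  by (force simp: threads_def at_most_one_each_def thread_def)

text \<open>The bound on the length leaves one arc or two, the empty walk being excluded by
  \<open>u \<noteq> v\<close>. The vertex \<open>w\<close> is the inner vertex of the path, whose
  bar is the one that may be crossed.\<close>

lemma path_thread:
  assumes "awalk u p v" "length p \<le> 2" "u \<noteq> v"
  obtains T w where "T \<in> threads" "pos u \<in> T" "pos v \<in> T" "height u < height v"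
    "\<And>z. z \<in> verts G \<Longrightarrow> pos z \<in> T \<Longrightarrow> z \<in> {u, v, w}"
proof -
  consider e where "p = [e]" | e f where "p = [e, f]"
    using assms by (cases p rule: remdups_adj.cases) (auto simp: awalk_Nil_iff)
  then show ?thesis
  proof cases
    case (1 e)
    then have e: "e \<in> arcs G" "tail G e = u" "head G e = v"
      using assms by (auto simp: awalk_simps)
    \<comment> \<open>A single arc is a thread whose middle vertex is its tail, so \<open>w\<close>
      is chosen as \<open>u\<close>.\<close>
    let ?T = "thread {} u {e}"
    have "?T \<in> threads"
      using e by (force simp: threads_def at_most_one_each_def out_arcs_def)
    moreover have "z \<in> {u, v, u}" if "z \<in> verts G" "pos z \<in> ?T" for z
      using that e vertex_on_arc[of e z] pos_inj[of z u] by (auto simp: thread_def)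
    ultimately show ?thesis
      using that[of ?T u] e arc_ends[of e] arc_rises[of e] by (auto simp: thread_def)
  next
    case (2 e f)
    then have e: "e \<in> arcs G" "f \<in> arcs G" "tail G e = u" "tail G f = head G e" "head G f = v"
      using assms by (auto simp: awalk_simps)
    let ?w = "head G e"
    let ?T = "thread {e} ?w {f}"
    have "?T \<in> threads"
      using e by (force simp: threads_def at_most_one_each_def in_arcs_def out_arcs_def)
    moreover have "z \<in> {u, v, ?w}" if "z \<in> verts G" "pos z \<in> ?T" for z
      using that e vertex_on_arc[of e z] vertex_on_arc[of f z] pos_inj[of z ?w]
      by (auto simp: thread_def)
    ultimately show ?thesis
      using that[of ?T ?w] e arc_ends[of e] arc_ends[of f] arc_rises[of e] arc_rises[of f]
      by (auto simp: thread_def)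
  qed
qed

end

section \<open>Columns and bars\<close>

locale numbered_1_flow_drawing = upward_1_flow_drawing +
  fixes r :: "(real \<times> real) set \<Rightarrow> nat"
  assumes r: "\<And>S T. S \<in> threads \<Longrightarrow> T \<in> threads \<Longrightarrow> left_of S T \<Longrightarrow> r S < r T"
begin

definition cols :: "'a \<Rightarrow> nat set" where
  "cols v = r ` {T \<in> threads. pos v \<in> T}"

text \<open>The extra 1/2 gives positive width even to a bar with a single column, yet stops short
  of the next integer column. Distinct threads may share a number.\<close>

definition vbar :: "'a \<Rightarrow> (real \<times> real) set" where
  "vbar v = {real (Min (cols v))..real (Max (cols v)) + 1/2} \<times> {height v}"

lemma finite_cols: "finite (cols v)"
  using finite_threads by (simp add: cols_def)

lemma cols_nonempty: "v \<in> verts G \<Longrightarrow> cols v \<noteq> {}"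
  using vertex_thread by (auto simp: cols_def)

lemma bar_vbar:
  assumes "v \<in> verts G"
  shows "bar (vbar v)"
proof -
  have "Min (cols v) \<le> Max (cols v)"
    using Min_le[OF finite_cols Max_in[OF finite_cols cols_nonempty[OF assms]]] .
  then have "real (Min (cols v)) < real (Max (cols v)) + 1/2"
    by simp
  then show ?thesis
    unfolding bar_def vbar_def by blast
qed

text \<open>At equal heights, every thread through the left vertex is left of every thread through
  the right one. The column numbers are thus separated by at least 1, more than the added
  1/2.\<close>

lemma disjnt_vbar:
  assumes "v \<in> verts G" "w \<in> verts G" "v \<noteq> w"
  shows "disjnt (vbar v) (vbar w)"
proof (cases "height v = height w")
  case True
  have *: "disjnt (vbar v) (vbar w)"
    if vw: "v \<in> verts G" "w \<in> verts G" "height v = height w" "fst (pos v) < fst (pos w)" for v w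
  proof -
    obtain S where S: "S \<in> threads" "pos v \<in> S" "r S = Max (cols v)"
      using Max_in[OF finite_cols cols_nonempty[OF vw(1)]] by (auto simp: cols_def)
    obtain T where T: "T \<in> threads" "pos w \<in> T" "r T = Min (cols w)"
      using Min_in[OF finite_cols cols_nonempty[OF vw(2)]] by (auto simp: cols_def)
    have "left_of S T"
      unfolding left_of_def using vw S T by (metis prod.collapse)
    then have "Max (cols v) < Min (cols w)"
      using r S T by metis
    then show ?thesis
      by (auto simp: vbar_def disjnt_def)
  qed
  have "fst (pos v) \<noteq> fst (pos w)"
    using pos_inj[OF assms(1,2)] assms(3) True by (auto simp: prod_eq_iff)
  then show ?thesis
    using *[of v w] *[of w v] assms True by (auto simp: disjnt_sym linorder_neq_iff)
next
  case False
  then show ?thesis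
    by (auto simp: vbar_def disjnt_def)
qed

lemma inj_on_vbar: "inj_on vbar (verts G)"
proof (rule inj_onI, rule ccontr)
  fix v w assume "v \<in> verts G" "w \<in> verts G" "vbar v = vbar w" "v \<noteq> w"
  then have "vbar v = {}"
    using disjnt_vbar[of v w] by (simp add: disjnt_def)
  moreover obtain x y z where "x < y" "vbar v = {x..y} \<times> {z}"
    using bar_vbar[OF \<open>v \<in> verts G\<close>] unfolding bar_def by blast
  ultimately show False by auto
qed

lemma column_in_vbar:
  assumes "T \<in> threads" "pos v \<in> T"
  shows "{real (r T)..real (r T) + 1/2} \<times> {height v} \<subseteq> vbar v"
proof -
  have "r T \<in> cols v"
    using assms by (auto simp: cols_def)
  then have "Min (cols v) \<le> r T" "r T \<le> Max (cols v)"
    using finite_cols by auto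
  then show ?thesis
    by (auto simp: vbar_def)
qed

text \<open>The threads \<open>L\<close> and \<open>U\<close> with the extreme columns of
  \<open>v\<close> both pass through \<open>pos v\<close>. The column of \<open>T\<close> lies
  between theirs, so at this height \<open>T\<close> can be neither left nor right of
  \<open>pos v\<close>.\<close>

lemma column_meets_vbar:
  assumes T: "T \<in> threads" and v: "v \<in> verts G" and a: "(a, height v) \<in> T"
    and x: "(x, height v) \<in> vbar v" "real (r T) \<le> x" "x \<le> real (r T) + 1/2"
  shows "pos v \<in> T"
proof -
  obtain L where L: "L \<in> threads" "pos v \<in> L" "r L = Min (cols v)"
    using Min_in[OF finite_cols cols_nonempty[OF v]] by (auto simp: cols_def)
  obtain U where U: "U \<in> threads" "pos v \<in> U" "r U = Max (cols v)"
    using Max_in[OF finite_cols cols_nonempty[OF v]] by (auto simp: cols_def)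
  \<comment> \<open>Column numbers are integers, so an overlap up to 1/2 on either side already
    gives the exact inequalities.\<close>
  have "r L \<le> r T" "r T \<le> r U"
    using x L U by (auto simp: vbar_def)
  then have "\<not> left_of T L" "\<not> left_of U T"
    using r T L U by (meson leD)+
  then have "a = fst (pos v)"
    using a L U unfolding left_of_def by (metis linorder_neqE prod.collapse)
  then show ?thesis
    using a by simp
qed

text \<open>The column of \<open>T\<close> is the visibility rectangle. As \<open>T\<close> has a
  point at every height between \<open>u\<close> and \<open>v\<close>, each bar met there belongs to
  a vertex on \<open>T\<close>.\<close>

lemma one_visible_vbar:
  assumes T: "T \<in> threads" "pos u \<in> T" "pos v \<in> T" "height u < height v"
    and on_T: "\<And>z. z \<in> verts G \<Longrightarrow> pos z \<in> T \<Longrightarrow> z \<in> {u, v, w}"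
  shows "one_visible (vbar ` verts G) (vbar u) (vbar v)"
proof -
  let ?x = "real (r T)"
  have "strand T"
    using T(1) by (rule strand_if_thread)
  have sub: "{d \<in> vbar ` verts G - {vbar u, vbar v}.
      d \<inter> ({?x..?x + 1/2} \<times> {height u..height v}) \<noteq> {}} \<subseteq> {vbar w}"
  proof
    fix d assume "d \<in> {d \<in> vbar ` verts G - {vbar u, vbar v}.
      d \<inter> ({?x..?x + 1/2} \<times> {height u..height v}) \<noteq> {}}"
    then obtain z x y where z: "z \<in> verts G" "d = vbar z" "d \<noteq> vbar u" "d \<noteq> vbar v"
      and xy: "(x, y) \<in> vbar z" "?x \<le> x" "x \<le> ?x + 1/2" "height u \<le> y" "y \<le> height v"
      by fastforce
    have "y = height z"
      using xy(1) by (simp add: vbar_def)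
    obtain a where "(a, y) \<in> T"
      by (rule strand_between[OF \<open>strand T\<close> T(2,3) xy(4,5)])
    then have "pos z \<in> T"
      using column_meets_vbar[OF T(1) z(1) _ _ xy(2,3)] xy(1) \<open>y = height z\<close> by simp
    then show "d \<in> {vbar w}"
      using on_T[OF z(1)] z(2-4) by auto
  qed
  have "card {d \<in> vbar ` verts G - {vbar u, vbar v}.
      d \<inter> ({?x..?x + 1/2} \<times> {height u..height v}) \<noteq> {}} \<le> 1"
    using card_mono[OF _ sub] by simp
  moreover have "{?x..?x + 1/2} \<times> {height u} \<subseteq> vbar u" "{?x..?x + 1/2} \<times> {height v} \<subseteq> vbar v"
    using column_in_vbar T by blast+
  ultimately show ?thesis
    unfolding one_visible_def using T(4)
    by (intro exI[of _ ?x] exI[of _ "?x + 1/2"] exI[of _ "height u"] exI[of _ "height v"]) simp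
qed

end

section \<open>Transport of the square to the bars\<close>

lemma one_visible_sym: "one_visible B b c \<Longrightarrow> one_visible B c b"
  unfolding one_visible_def insert_commute[of c b] by blast

theorem theorem3:
  fixes G :: "('a, 'b) pre_digraph"
  assumes "planar_1_flow_network G"
  shows "weak_bar_1_visibility_graph (with_proj (undirected_square G))"
proof -
  obtain pos curve where "upward_1_flow_drawing G pos curve"
    using assms unfolding planar_1_flow_network_def upward_planar_def upward_1_flow_drawing_def
      upward_1_flow_drawing_axioms_def by blast
  then interpret D: upward_1_flow_drawing G pos curve .
  have "\<exists>r :: _ \<Rightarrow> nat. \<forall>S\<in>D.threads. \<forall>T\<in>D.threads. left_of S T \<longrightarrow> r S < r T"
    using D.finite_threads D.strand_if_thread D.left_of_asym_threads by (rule strand_numbering)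
  then obtain r :: "_ \<Rightarrow> nat"
    where r: "\<forall>S\<in>D.threads. \<forall>T\<in>D.threads. left_of S T \<longrightarrow> r S < r T"
    by blast
  interpret D: numbered_1_flow_drawing G pos curve r
    by unfold_locales (use r in blast)
  let ?Q = "undirected_square G"
  let ?B = "D.vbar ` verts G"
  \<comment> \<open>The spanning subgraph is the image of the square under \<open>vbar\<close>, so
    isomorphism needs only injectivity, and the work is to show that its arcs are 1-visible
    pairs.\<close>
  define H where "H = \<lparr> pverts = ?B, parcs = map_prod D.vbar D.vbar ` parcs ?Q \<rparr>"
  have Q: "u \<in> verts G" "v \<in> verts G" "u \<noteq> v" "(v, u) \<in> parcs ?Q"
      "one_visible ?B (D.vbar u) (D.vbar v)" if uv: "(u, v) \<in> parcs ?Q" for u v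
  proof -
    obtain p where p: "u \<noteq> v" "length p \<le> 2" "D.apath u p v \<or> D.apath v p u"
      using uv by (auto simp: undirected_square_def)
    then show "u \<noteq> v" "u \<in> verts G" "v \<in> verts G" "(v, u) \<in> parcs ?Q"
      by (auto simp: undirected_square_def D.apath_def
          dest: D.awalk_hd_in_verts D.awalk_last_in_verts)
    \<comment> \<open>The path may run either way between \<open>u\<close> and \<open>v\<close>,
      hence the statement for arbitrary ends.\<close>
    have vis: "one_visible ?B (D.vbar a) (D.vbar b)" if "D.awalk a p b" "a \<noteq> b" for a b
      using D.path_thread[OF that(1) p(2) that(2)] D.one_visible_vbar by metis
    show "one_visible ?B (D.vbar u) (D.vbar v)"
      using p vis[of u v] one_visible_sym[OF vis[of v u]] by (auto simp: D.apath_def)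
  qed
  have "bar_layout ?B"
    using D.bar_vbar D.disjnt_vbar by (auto simp: bar_layout_def pairwise_def)
  moreover have verts_Q: "pverts ?Q = verts G"
    by (simp add: undirected_square_def)
  moreover have H_arc: "b \<in> ?B \<and> c \<in> ?B \<and> b \<noteq> c \<and> (c, b) \<in> parcs H \<and> one_visible ?B b c"
    if bc: "(b, c) \<in> parcs H" for b c
  proof -
    obtain u v where uv: "(u, v) \<in> parcs ?Q" "b = D.vbar u" "c = D.vbar v"
      using bc by (auto simp: H_def)
    have "(c, b) \<in> parcs H"
      unfolding H_def uv using map_prod_imageI[OF Q(4)[OF uv(1)]] by simp
    moreover have "b \<noteq> c"
      using uv Q(1-3)[OF uv(1)] inj_onD[OF D.inj_on_vbar] by blast
    ultimately show ?thesis
      using uv Q(1,2,5)[OF uv(1)] by blast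
  qed
  have verts_H: "pverts H = ?B"
    by (simp add: H_def)
  have "pair_graph H"
  proof -
    have "parcs H \<subseteq> ?B \<times> ?B"
      using H_arc by (intro subrelI) blast
    then have "finite (parcs H)"
      by (rule finite_subset) simp
    moreover have "finite (pverts H)"
      using verts_H by simp
    moreover have "sym (parcs H)"
      using H_arc by (intro symI) blast
    ultimately show ?thesis
      using H_arc verts_H by unfold_locales (auto simp: symmetric_def)
  qed
  then interpret H: pair_graph H .
  have "graph (with_proj H)"
    by unfold_locales
  moreover have "spanning (with_proj H) (with_proj (bar_1_visibility_graph ?B))"
  proof -
    have "wf_digraph (with_proj (bar_1_visibility_graph ?B))"
      by unfold_locales (auto simp: bar_1_visibility_graph_def)
    then show ?thesis
      unfolding spanning_def subgraph_def compatible_def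
      using H_arc H.wf_digraph verts_H by (auto simp: bar_1_visibility_graph_def)
  qed
  moreover have "digraph_iso (with_proj ?Q) (with_proj H)"
  proof -
    \<comment> \<open>Arcs of the image are pairs of bars, so their tail and head are the two
      projections.\<close>
    let ?f = "\<lparr> iso_verts = D.vbar, iso_arcs = map_prod D.vbar D.vbar,
      iso_head = snd, iso_tail = fst \<rparr>"
    have "wf_digraph (with_proj ?Q)"
      by unfold_locales (auto simp: verts_Q dest: Q(1,2))
    moreover have "inj_on (map_prod D.vbar D.vbar) (parcs ?Q)"
      by (rule inj_on_subset[OF map_prod_inj_on[OF D.inj_on_vbar D.inj_on_vbar]])
        (auto dest: Q(1,2))
    ultimately have "pre_digraph.digraph_isomorphism (with_proj ?Q) ?f"
      using D.inj_on_vbar by (auto simp: pre_digraph.digraph_isomorphism_def verts_Q)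
    moreover have "with_proj H = app_iso ?f (with_proj ?Q)"
      by (simp add: with_proj_def app_iso_def H_def verts_Q)
    ultimately show ?thesis
      unfolding digraph_iso_def by blast
  qed
  ultimately show ?thesis
    unfolding weak_bar_1_visibility_graph_def by blast
qed

end
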